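(* Let $(X,d)$ be a metric $G$-space and let $f:X\to X$ be a continuous map which is equivariant. Let $\{n_i\}_{i=0}^\infty$ be a sequence of positive integers and let $\{A_i\}_{i=0}^\infty$ and $\{B_i\}_{i=0}^\infty$ be decreasing sequences of compact subsets of $X$ satisfying $$\bigcap_{i=0}^\infty A_i=\{a\},\qquad \bigcap_{i=0}^\infty B_i=\{b\},$$ where $a,b\in X$ and $a\neq b$. If for every $i\ge 0$ there exists $g_i\in G$ such that $$A_{i+1}\cup B_{i+1}\subset g_if^{n_i}(A_i)\cap g_if^{n_i}(B_i),$$ then $f$ is chaotic in the sense of $G$-Li-Yorke.
   Context: Metric $G$-space: $(X,d)$ is a metric space, $G$ is a topological group with identity $e$, and $\varphi:G\times X\to X$ is a continuous map, written $\varphi(g,x)=gx$, such that $ex=x$ for all $x\in X$ and $g_1(g_2x)=(g_1g_2)x$ for all $x\in X$ and $g_1,g_2\in G$. For $A\subset X$, $gf^n(A)=\{gf^n(x): x\in A\}$. Equivariant: $f(gx)=gf(x)$ for all $x\in X$ and all $g\in G$. $G$-Li-Yorke chaos: a set $Y\subset X$ is a $G$-Li-Yorke chaotic set of $f$ if it contains at least two points and for any two distinct points $x,y\in Y$ there exists a sequence $\{g_n\}_{n=1}^\infty\subset G$ (possibly depending on $x,y$) with $$\liminf_{n\to\infty} d(g_nf^n(x),g_nf^n(y))=0,\qquad \limsup_{n\to\infty} d(g_nf^n(x),g_nf^n(y))>0.$$ The map $f$ is chaotic in the sense of $G$-Li-Yorke if it has an uncountable $G$-Li-Yorke chaotic set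 $S\subset X$. *)

theory Defs
  imports "HOL-Analysis.Analysis"
begin

text \<open>
  A metric G-space: X is the metric space on the type \<open>'x\<close>, G is the topological group on the
  type \<open>'g\<close>. The library writes topological groups additively, but the class
  \<open>topological_group_add\<close> does not assume commutativity: \<open>g + h\<close> is the product \<open>gh\<close> and
  \<open>0\<close> is the identity \<open>e\<close>.
\<close>

definition metric_G_space ::
  "('g::topological_group_add \<Rightarrow> 'x::metric_space \<Rightarrow> 'x) \<Rightarrow> bool" where
  "metric_G_space \<phi> \<longleftrightarrow>
     continuous_on UNIV (\<lambda>(g, x). \<phi> g x) \<and>
     (\<forall>x. \<phi> 0 x = x) \<and>
     (\<forall>g1 g2 x. \<phi> g1 (\<phi> g2 x) = \<phi> (g1 + g2) x)"

definition equivariant :: "('g \<Rightarrow> 'x \<Rightarrow> 'x) \<Rightarrow> ('x \<Rightarrow> 'x) \<Rightarrow> bool" where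
  "equivariant \<phi> f \<longleftrightarrow> (\<forall>g x. f (\<phi> g x) = \<phi> g (f x))"

text \<open>
  The lower and upper limits are taken in the extended reals, since the distances need not be
  bounded and the upper limit may be infinite. The sequence \<open>g\<close> has an extra entry \<open>g 0\<close>,
  which does not affect these limits.
\<close>

definition G_Li_Yorke_chaotic_set ::
  "('g \<Rightarrow> 'x::metric_space \<Rightarrow> 'x) \<Rightarrow> ('x \<Rightarrow> 'x) \<Rightarrow> 'x set \<Rightarrow> bool" where
  "G_Li_Yorke_chaotic_set \<phi> f Y \<longleftrightarrow>
     (\<exists>x\<in>Y. \<exists>y\<in>Y. x \<noteq> y) \<and>
     (\<forall>x\<in>Y. \<forall>y\<in>Y. x \<noteq> y \<longrightarrow>
        (\<exists>g :: nat \<Rightarrow> 'g.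
           liminf (\<lambda>n. ereal (dist (\<phi> (g n) ((f ^^ n) x)) (\<phi> (g n) ((f ^^ n) y)))) = 0 \<and>
           limsup (\<lambda>n. ereal (dist (\<phi> (g n) ((f ^^ n) x)) (\<phi> (g n) ((f ^^ n) y)))) > 0))"

definition G_Li_Yorke_chaotic ::
  "('g \<Rightarrow> 'x::metric_space \<Rightarrow> 'x) \<Rightarrow> ('x \<Rightarrow> 'x) \<Rightarrow> bool" where
  "G_Li_Yorke_chaotic \<phi> f \<longleftrightarrow> (\<exists>S. uncountable S \<and> G_Li_Yorke_chaotic_set \<phi> f S)"

end

theory Submission
  imports Defs "HOL-Library.Nat_Bijection"
begin

text \<open>
  Put \<open>F\<^sub>i = g\<^sub>i f\<^bsup>n\<^sub>i\<^esup>\<close>. By compactness every choice of \<open>C\<^sub>i \<in> {A\<^sub>i, B\<^sub>i}\<close> is realised by a point whose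
  orbit under the compositions \<open>F\<^bsub>i-1\<^esub> \<circ> \<dots> \<circ> F\<^sub>0\<close> visits \<open>C\<^sub>i\<close> at time \<open>i\<close>. Equivariance
  turns this composition into \<open>h\<^sub>i f\<^bsup>N\<^sub>i\<^esup>\<close> with \<open>h\<^sub>i \<in> G\<close> and \<open>N\<^sub>i\<close> strictly increasing. Since \<open>A\<^sub>i\<close> and
  \<open>B\<^sub>i\<close> shrink to \<open>a\<close> and \<open>b\<close>, two such orbits come together if their itineraries agree infinitely
  often and separate by about \<open>d(a,b)\<close> if they differ infinitely often; there are uncountably many
  itineraries any two of which do both.
\<close>

section \<open>Compactness and orbits with a prescribed itinerary\<close>

primrec iterate_seq :: "(nat \<Rightarrow> 'a \<Rightarrow> 'a) \<Rightarrow> nat \<Rightarrow> 'a \<Rightarrow> 'a" where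
  "iterate_seq F 0 x = x"
| "iterate_seq F (Suc i) x = F i (iterate_seq F i x)"

lemma continuous_on_iterate_seq:
  fixes F :: "nat \<Rightarrow> 'a::topological_space \<Rightarrow> 'a"
  assumes "\<And>i. continuous_on UNIV (F i)"
  shows "continuous_on UNIV (iterate_seq F i)"
proof (induction i)
  case (Suc i)
  show ?case
    using continuous_on_compose2[OF assms Suc] by simp
qed simp

text \<open>The endpoint is pulled back one map at a time: \<open>y\<close> has a preimage in
  \<open>C k\<close>, to which the induction hypothesis applies because \<open>y\<close> is kept
  arbitrary.\<close>

lemma iterate_seq_itinerary_finite:
  assumes "\<And>i. C (Suc i) \<subseteq> F i ` C i" and "y \<in> C k"
  shows "\<exists>x. iterate_seq F k x = y \<and> (\<forall>i\<le>k. iterate_seq F i x \<in> C i)"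
  using assms(2)
proof (induction k arbitrary: y)
  case 0
  then show ?case by auto
next
  case (Suc k)
  then obtain z where "z \<in> C k" "y = F k z"
    using assms(1) by blast
  with Suc show ?case
    by (metis iterate_seq.simps(2) le_Suc_eq)
qed

lemma decseq_compact_eventually_subset:
  fixes A :: "nat \<Rightarrow> 'a::t2_space set"
  assumes "decseq A" and "\<And>i. compact (A i)" and "(\<Inter>i. A i) \<subseteq> U" and "open U"
  shows "\<forall>\<^sub>F i in sequentially. A i \<subseteq> U"
proof -
  \<comment> \<open>A point outside \<open>U\<close> misses some \<open>A i\<close>, so these open
    sets cover even the whole space.\<close>
  have "A 0 \<subseteq> (\<Union>i\<in>UNIV. U \<union> - A i)" using assms(3) by blast
  moreover have "open (U \<union> - A i)" for i
    using assms(2,4) by (simp add: open_Un compact_imp_closed open_Compl)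
  ultimately obtain I where I: "finite I" "A 0 \<subseteq> (\<Union>i\<in>I. U \<union> - A i)"
    using compactE_image[OF assms(2)[of 0], of UNIV "\<lambda>i. U \<union> - A i"] by metis
  \<comment> \<open>Inserting \<open>0\<close> keeps \<open>Max\<close> meaningful when the finite
    subcover is empty.\<close>
  have "A k \<subseteq> U" if "Max (insert 0 I) \<le> k" for k
  proof
    fix x assume "x \<in> A k"
    moreover have "i \<le> k" if "i \<in> I" for i
      using \<open>finite I\<close> \<open>Max (insert 0 I) \<le> k\<close> that by simp
    ultimately have "x \<in> A 0" "\<forall>i\<in>I. x \<in> A i"
      using decseqD[OF assms(1)] by blast+
    with I(2) show "x \<in> U" by blast
  qed
  then show ?thesis unfolding eventually_sequentially by blast
qed

text \<open>Cantor's intersection theorem, obtained by taking \<open>U\<close> empty in the previous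
  lemma.\<close>

lemma decseq_compact_Inter_nonempty:
  fixes A :: "nat \<Rightarrow> 'a::t2_space set"
  assumes "decseq A" and "\<And>i. compact (A i)" and "\<And>i. A i \<noteq> {}"
  shows "(\<Inter>i. A i) \<noteq> {}"
proof
  assume "(\<Inter>i. A i) = {}"
  then have "\<forall>\<^sub>F i in sequentially. A i \<subseteq> {}"
    using assms(1,2) by (intro decseq_compact_eventually_subset) auto
  with assms(3) show False by simp
qed

text \<open>The points that follow \<open>C\<close> up to time \<open>k\<close> form a decreasing
  sequence of nonempty compact sets, and a common point follows \<open>C\<close> forever.\<close>

lemma iterate_seq_itinerary:
  fixes F :: "nat \<Rightarrow> 'a::t2_space \<Rightarrow> 'a"
  assumes cont: "\<And>i. continuous_on UNIV (F i)"
    and comp: "\<And>i. compact (C i)" and ne: "\<And>i. C i \<noteq> {}"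
    and cover: "\<And>i. C (Suc i) \<subseteq> F i ` C i"
  shows "\<exists>x. \<forall>i. iterate_seq F i x \<in> C i"
proof -
  \<comment> \<open>The preimages are only closed; intersecting them with \<open>C 0\<close> gives
    compactness.\<close>
  define K where "K = (\<lambda>k. C 0 \<inter> (\<Inter>i\<in>{..k}. iterate_seq F i -` C i))"
  have "compact (K k)" for k
    unfolding K_def
    by (intro compact_Int_closed comp closed_INT ballI closed_vimage compact_imp_closed
        continuous_on_iterate_seq cont)
  moreover have "K k \<noteq> {}" for k
  proof -
    obtain y where "y \<in> C k" using ne by blast
    then obtain x where "\<forall>i\<le>k. iterate_seq F i x \<in> C i"
      using iterate_seq_itinerary_finite[of C F, OF cover] by blast
    then have "x \<in> K k" by (force simp: K_def)
    then show ?thesis by blast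
  qed
  moreover have "decseq K"
    by (intro decseq_SucI) (auto simp: K_def)
  ultimately have "(\<Inter>k. K k) \<noteq> {}"
    by (intro decseq_compact_Inter_nonempty)
  then show ?thesis by (fastforce simp: K_def)
qed

section \<open>Limits from frequent events, and a family of itineraries\<close>

lemma liminf_ereal_eq_0I:
  fixes X :: "nat \<Rightarrow> real"
  assumes "\<And>n. 0 \<le> X n" and "\<And>e. 0 < e \<Longrightarrow> \<exists>\<^sub>F n in sequentially. X n < e"
  shows "liminf (\<lambda>n. ereal (X n)) = 0"
proof (rule antisym)
  show "0 \<le> liminf (\<lambda>n. ereal (X n))"
    using assms(1) by (intro Liminf_bounded) simp
  show "liminf (\<lambda>n. ereal (X n)) \<le> 0"
  proof (rule ccontr)
    assume "\<not> ?thesis"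
    then obtain e where e: "0 < ereal e" "ereal e < liminf (\<lambda>n. ereal (X n))"
      using ereal_dense2 by (metis not_le)
    have "\<forall>\<^sub>F n in sequentially. \<not> X n < e"
      using less_LiminfD[OF e(2)] by (rule eventually_mono) simp
    with assms(2)[of e] e(1) show False by (simp add: frequently_def)
  qed
qed

lemma limsup_ereal_posI:
  fixes X :: "nat \<Rightarrow> real"
  assumes "0 < e" and "\<exists>\<^sub>F n in sequentially. e \<le> X n"
  shows "0 < limsup (\<lambda>n. ereal (X n))"
proof (rule ccontr)
  assume "\<not> ?thesis"
  then have "limsup (\<lambda>n. ereal (X n)) < ereal e"
    using assms(1) by (metis ereal_less(2) not_le order_le_less_trans)
  then have "\<forall>\<^sub>F n in sequentially. \<not> e \<le> X n"
    by (rule eventually_mono[OF Limsup_lessD]) simp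
  with assms(2) show False by (simp add: frequently_def)
qed

text \<open>Orbits are controlled only at the times \<open>N i\<close>; this passes from them to all
  times.\<close>

lemma frequently_sequentially_strict_mono:
  fixes N :: "nat \<Rightarrow> nat"
  assumes "strict_mono N" and "\<exists>\<^sub>F i in sequentially. P (N i)"
  shows "\<exists>\<^sub>F n in sequentially. P n"
  using assms eventually_subseq[OF assms(1), of "\<lambda>n. \<not> P n"]
  by (auto simp: frequently_def)

lemma uncountable_UNIV_nat_set: "uncountable (UNIV :: nat set set)"
proof
  assume "countable (UNIV :: nat set set)"
  then have "range (from_nat_into (UNIV :: nat set set)) = Pow UNIV"
    by (simp add: range_from_nat_into)
  then show False using Cantors_theorem by blast
qed

text \<open>
  Each \<open>m\<close> is the first component of infinitely many indices. Index \<open>0\<close> is kept out of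
  \<open>Suc ` u\<close>, so that any two itineraries agree infinitely often.
\<close>

definition itinerary :: "nat set \<Rightarrow> nat \<Rightarrow> bool" where
  "itinerary u i \<longleftrightarrow> fst (prod_decode i) \<in> Suc ` u"

text \<open>The code of the pair \<open>(m, j)\<close> is at least \<open>j\<close>, so such indices
  are unbounded.\<close>

lemma frequently_fst_prod_decode: "\<exists>\<^sub>F i in sequentially. fst (prod_decode i) = m"
  unfolding frequently_sequentially
  by (metis fst_conv le_prod_encode_2 prod_encode_inverse)

lemma frequently_itinerary_eq: "\<exists>\<^sub>F i in sequentially. itinerary u i = itinerary v i"
  by (rule frequently_elim1[OF frequently_fst_prod_decode[of 0]]) (simp add: itinerary_def)

lemma frequently_itinerary_neq:
  assumes "u \<noteq> v"
  shows "\<exists>\<^sub>F i in sequentially. itinerary u i \<noteq> itinerary v i"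
proof -
  obtain m where "(m \<in> u) \<noteq> (m \<in> v)" using assms by blast
  then show ?thesis
    by (intro frequently_elim1[OF frequently_fst_prod_decode[of "Suc m"]])
      (auto simp: itinerary_def)
qed

section \<open>Equivariant iteration and the chaotic set\<close>

lemma metric_G_space_continuous_on:
  assumes "metric_G_space \<phi>"
  shows "continuous_on UNIV (\<phi> g)"
proof -
  have "continuous_on UNIV (\<lambda>(g, x). \<phi> g x)"
    using assms by (simp add: metric_G_space_def)
  then show ?thesis
    using continuous_on_compose2[of UNIV "\<lambda>(g, x). \<phi> g x" UNIV "Pair g"]
    by (simp add: continuous_on_Pair)
qed

lemma continuous_on_funpow:
  fixes f :: "'a::topological_space \<Rightarrow> 'a"
  assumes "continuous_on UNIV f"
  shows "continuous_on UNIV (f ^^ k)"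
proof (induction k)
  case (Suc k)
  then show ?case
    using continuous_on_compose2[OF assms Suc] by (simp add: comp_def)
qed (simp add: id_def)

lemma equivariant_funpow:
  assumes "equivariant \<phi> f"
  shows "(f ^^ k) (\<phi> g x) = \<phi> g ((f ^^ k) x)"
  using assms by (induction k) (auto simp: equivariant_def)

text \<open>Equivariance moves the accumulated \<open>h\<close> past the next power of
  \<open>f\<close>, and \<open>g k\<close> then multiplies it from the left. As \<open>h\<close>
  does not depend on \<open>x\<close>, it serves both points of a pair.\<close>

lemma iterate_seq_equivariant:
  assumes "metric_G_space \<phi>" and "equivariant \<phi> f"
  shows "\<exists>h. \<forall>x. iterate_seq (\<lambda>i x. \<phi> (g i) ((f ^^ n i) x)) k x = \<phi> h ((f ^^ sum n {..<k}) x)"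
proof (induction k)
  case 0
  show ?case
    using assms(1) by (auto simp: metric_G_space_def intro!: exI[of _ 0])
next
  case (Suc k)
  then obtain h where
    "\<forall>x. iterate_seq (\<lambda>i x. \<phi> (g i) ((f ^^ n i) x)) k x = \<phi> h ((f ^^ sum n {..<k}) x)"
    by blast
  then show ?case
    using assms(1)
    by (auto simp: metric_G_space_def equivariant_funpow[OF assms(2)] add.commute[of _ "n k"]
        funpow_add intro!: exI[of _ "g k + h"])
qed

theorem proposition5p1:
  fixes \<phi> :: "'g::topological_group_add \<Rightarrow> 'x::metric_space \<Rightarrow> 'x"
    and f :: "'x \<Rightarrow> 'x"
    and n :: "nat \<Rightarrow> nat"
    and A B :: "nat \<Rightarrow> 'x set"
    and a b :: 'x
  assumes "metric_G_space \<phi>"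
    and "continuous_on UNIV f"
    and "equivariant \<phi> f"
    and "\<And>i. n i > 0"
    and "decseq A" and "\<And>i. compact (A i)"
    and "decseq B" and "\<And>i. compact (B i)"
    and "(\<Inter>i. A i) = {a}" and "(\<Inter>i. B i) = {b}" and "a \<noteq> b"
    and "\<And>i. \<exists>g. A (Suc i) \<union> B (Suc i) \<subseteq>
           (\<lambda>x. \<phi> g ((f ^^ n i) x)) ` A i \<inter> (\<lambda>x. \<phi> g ((f ^^ n i) x)) ` B i"
  shows "G_Li_Yorke_chaotic \<phi> f"
proof -
  obtain g where g: "\<And>i. A (Suc i) \<union> B (Suc i) \<subseteq>
      (\<lambda>x. \<phi> (g i) ((f ^^ n i) x)) ` A i \<inter> (\<lambda>x. \<phi> (g i) ((f ^^ n i) x)) ` B i"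
    using assms(12) by metis
  define T where "T = iterate_seq (\<lambda>i x. \<phi> (g i) ((f ^^ n i) x))"
  define N where "N = (\<lambda>i. sum n {..<i})"
  obtain h where h: "\<And>i x. T i x = \<phi> (h i) ((f ^^ N i) x)"
    using iterate_seq_equivariant[OF assms(1,3), of g n] unfolding T_def N_def by metis
  have N: "strict_mono N"
    using assms(4) by (simp add: strict_mono_Suc_iff N_def)
  \<comment> \<open>Chaos asks for a group element at every time. Off the range of \<open>N\<close>
    the value is arbitrary, which is harmless since only frequent behaviour along \<open>N\<close>
    matters.\<close>
  define G where "G = (\<lambda>k. h (inv N k))"
  have G: "T i x = \<phi> (G (N i)) ((f ^^ N i) x)" for i x
    using h strict_mono_imp_inj_on[OF N] by (simp add: G_def)
  define C where "C = (\<lambda>u i. if itinerary u i then A i else B i)"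
  define c where "c = (\<lambda>u i. if itinerary u i then a else b)"
  have c_in_C: "c u i \<in> C u i" for u i
  proof -
    have "a \<in> A i" "b \<in> B i" using assms(9,10) by blast+
    then show ?thesis by (simp add: c_def C_def)
  qed
  have "continuous_on UNIV (\<lambda>x. \<phi> (g i) ((f ^^ n i) x))" for i
    using continuous_on_compose2[OF metric_G_space_continuous_on[OF assms(1)]
        continuous_on_funpow[OF assms(2)]] by simp
  moreover have "C u (Suc i) \<subseteq> (\<lambda>x. \<phi> (g i) ((f ^^ n i) x)) ` C u i" for u i
    using g[of i] by (simp add: C_def)
  moreover have "compact (C u i)" for u i
    using assms(6,8) by (simp add: C_def)
  moreover have "C u i \<noteq> {}" for u i
    using c_in_C by blast
  ultimately have "\<exists>x. \<forall>i. T i x \<in> C u i" for u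
    unfolding T_def by (intro iterate_seq_itinerary) auto
  then obtain p where p: "\<And>u i. T i (p u) \<in> C u i" by metis
  have near: "\<forall>\<^sub>F i in sequentially. \<forall>u. dist (T i (p u)) (c u i) < e" if "e > 0" for e
  proof -
    have "\<forall>\<^sub>F i in sequentially. A i \<subseteq> ball a e" "\<forall>\<^sub>F i in sequentially. B i \<subseteq> ball b e"
      using assms(5-10) that by (auto intro!: decseq_compact_eventually_subset)
    then show ?thesis
    proof eventually_elim
      case (elim i)
      show ?case
      proof
        fix u
        have "C u i \<subseteq> ball (c u i) e" using elim by (simp add: C_def c_def)
        with p[of i u] show "dist (T i (p u)) (c u i) < e"
          by (auto simp: dist_commute)
      qed
    qed
  qed
  have close: "\<exists>\<^sub>F i in sequentially. dist (T i (p u)) (T i (p v)) < e" if "e > 0" for u v e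
  proof (rule frequently_rev_mp[OF frequently_itinerary_eq[of u v]])
    show "\<forall>\<^sub>F i in sequentially. itinerary u i = itinerary v i \<longrightarrow>
        dist (T i (p u)) (T i (p v)) < e"
      using near[OF half_gt_zero[OF that]]
      by (rule eventually_mono) (metis c_def dist_triangle_half_l)
  qed
  \<comment> \<open>Two points within \<delta> of centres that are 3\<delta> apart remain at least
    \<delta> apart.\<close>
  define \<delta> where "\<delta> = dist a b / 3"
  have "\<delta> > 0" using assms(11) by (simp add: \<delta>_def)
  have far: "\<exists>\<^sub>F i in sequentially. \<delta> \<le> dist (T i (p u)) (T i (p v))" if "u \<noteq> v" for u v
  proof (rule frequently_rev_mp[OF frequently_itinerary_neq[OF that]])
    show "\<forall>\<^sub>F i in sequentially. itinerary u i \<noteq> itinerary v i \<longrightarrow>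
        \<delta> \<le> dist (T i (p u)) (T i (p v))"
      using near[OF \<open>\<delta> > 0\<close>]
    proof (rule eventually_mono, intro impI)
      fix i assume i: "\<forall>u. dist (T i (p u)) (c u i) < \<delta>" "itinerary u i \<noteq> itinerary v i"
      have "3 * \<delta> = dist (c u i) (c v i)"
        using i(2) by (auto simp: \<delta>_def c_def dist_commute)
      also have "\<dots> \<le> dist (T i (p u)) (c u i) + dist (T i (p u)) (T i (p v))
          + dist (T i (p v)) (c v i)"
        by metric
      finally show "\<delta> \<le> dist (T i (p u)) (T i (p v))"
        using i(1)[rule_format, of u] i(1)[rule_format, of v] by linarith
    qed
  qed
  \<comment> \<open>Separation already forces distinct index sets to give distinct points, so
    uncountability carries over to \<open>range p\<close>.\<close>
  have "inj p"
  proof (rule injI, rule ccontr)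
    fix u v assume "p u = p v" "u \<noteq> v"
    with far[of u v] \<open>\<delta> > 0\<close> show False by simp
  qed
  then have "uncountable (range p)"
    using uncountable_UNIV_nat_set countable_image_inj_on by blast
  moreover have "G_Li_Yorke_chaotic_set \<phi> f (range p)"
    unfolding G_Li_Yorke_chaotic_set_def
  proof (intro conjI ballI impI)
    show "\<exists>x\<in>range p. \<exists>y\<in>range p. x \<noteq> y"
      using injD[OF \<open>inj p\<close>, of "{}" UNIV] by blast
  next
    fix x y assume "x \<in> range p" "y \<in> range p" "x \<noteq> y"
    then obtain u v where uv: "x = p u" "y = p v" "u \<noteq> v" by blast
    let ?X = "\<lambda>k. dist (\<phi> (G k) ((f ^^ k) x)) (\<phi> (G k) ((f ^^ k) y))"
    have "\<exists>\<^sub>F k in sequentially. ?X k < e" if "e > 0" for e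
      by (rule frequently_sequentially_strict_mono[OF N])
        (use close[OF that, of u v] in \<open>simp add: uv G\<close>)
    then have "liminf (\<lambda>k. ereal (?X k)) = 0"
      by (intro liminf_ereal_eq_0I) auto
    moreover have "\<exists>\<^sub>F k in sequentially. \<delta> \<le> ?X k"
      by (rule frequently_sequentially_strict_mono[OF N])
        (use far[OF uv(3)] in \<open>simp add: uv G\<close>)
    then have "0 < limsup (\<lambda>k. ereal (?X k))"
      by (rule limsup_ereal_posI[OF \<open>\<delta> > 0\<close>])
    ultimately show "\<exists>g. liminf (\<lambda>k. ereal (dist (\<phi> (g k) ((f ^^ k) x)) (\<phi> (g k) ((f ^^ k) y)))) = 0 \<and>
        0 < limsup (\<lambda>k. ereal (dist (\<phi> (g k) ((f ^^ k) x)) (\<phi> (g k) ((f ^^ k) y))))"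
      by blast
  qed
  ultimately show ?thesis
    unfolding G_Li_Yorke_chaotic_def by blast
qed

end
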